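(* Let $V$ be a $\mathbb C$-vector space of finite dimension $r$, placed in homological degree $0$. The derived Harish-Chandra homomorphism $$\Phi_n:\ \mathrm{DRep}_n[\mathrm{Sym}(V)]^{\mathrm{GL}}\to\mathbf{Sym}\big(\mathfrak h_n^*\otimes(\wedge^1V\oplus\wedge^2V\oplus\dots\oplus\wedge^rV)\big)^{S_n}$$ is not a quasi-isomorphism when $r\ge3$ and $n\ge2$.
   Context: $\mathbf{Sym}$ denotes the graded symmetric algebra. The symmetric algebra $\mathrm{Sym}(V)$ has the cofibrant resolution $R$ given by the cobar construction of the coalgebra $\Lambda^c(sV)$ (exterior powers $\wedge^i(sV)$, $sV$ in degree $1$, $\wedge^i$ in degree $i$): $R$ is the tensor algebra generated by $\bigoplus_{i=1}^r\wedge^iV$, with $\wedge^iV$ placed in homological degree $i-1$, and the differential (of degree $-1$) is determined by the coproduct; writing $\lambda(v_1,\dots,v_m)\in\wedge^mV$ for generators, $$d\lambda(v_1,\dots,v_m)=\sum_{p+q=m,\,1\le p\le q}(-1)^p\sum_{\sigma}(-1)^\sigma[\lambda(v_{\sigma(1)},\dots,v_{\sigma(p)}),\lambda(v_{\sigma(p+1)},\dots,v_{\sigma(m)})],$$ the inner sum over $(p,q)$-shuffles $\sigma$ (e.g. $d\lambda(v_1,v_2)=-[v_1,v_2]$ and $d\lambda(v_1,v_2,v_3)=-[v_1,\lambda(v_2,v_3)]-[v_2,\lambda(v_3,v_1)]-[v_3,\lambda(v_1,v_2)]$). $\mathrm{DRep}_n(\mathrm{Sym}(V))=R_n$ is the commutative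 DG algebra generated by the matrix entries $a_{ij}$ ($1\le i,j\le n$) of the generators $a$ of $R$ — so as a graded algebra it is $\mathbf{Sym}[\mathcal M_n(\mathbb C)^*\otimes(\wedge^1V\oplus\dots\oplus\wedge^rV)]$ — with differential $d(a_{ij})=(da)_{ij}$, where $(ab)_{ij}=\sum_la_{il}b_{lj}$. $\mathrm{GL}_n$ acts by conjugation of matrices, and $\mathrm{DRep}_n(\cdot)^{\mathrm{GL}}$ is the DG subalgebra of invariants. $\mathfrak h_n\cong\mathbb C^n$ is the space of diagonal matrices, with $\mathfrak h_n^*$ having basis $e^1,\dots,e^n$ permuted by $S_n$; the target has zero differential. $\Phi_n$ is induced by $a_{ij}\mapsto\delta_{ij}\,e^i\otimes a$. *)

theory Defs
  imports
    "HOL-Analysis.Analysis"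
    "HOL-Library.Poly_Mapping"
    "HOL-Combinatorics.Permutations"
begin

section \<open>Free associative algebras over the complex numbers\<close>

text \<open>With lists as the free monoid, the finitely supported functions from words to scalars,
  with the convolution product of \<^theory>\<open>HOL-Library.Poly_Mapping\<close>, form the free unital
  associative algebra.\<close>

instantiation list :: (type) monoid_add
begin

definition zero_list :: "'a list" where "zero_list = []"
definition plus_list :: "'a list \<Rightarrow> 'a list \<Rightarrow> 'a list" where "plus_list = (@)"

instance
  by standard (simp_all add: zero_list_def plus_list_def)

end

type_synonym 's falg = "'s list \<Rightarrow>\<^sub>0 complex"

definition scalar :: "complex \<Rightarrow> 's falg" where
  "scalar c = Poly_Mapping.single [] c"

definition word :: "'s list \<Rightarrow> 's falg" where
  "word w = Poly_Mapping.single w 1"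

definition gen :: "'s \<Rightarrow> 's falg" where
  "gen s = word [s]"

definition lin_ext :: "('s list \<Rightarrow> 't falg) \<Rightarrow> 's falg \<Rightarrow> 't falg" where
  "lin_ext f x = (\<Sum>w\<in>Poly_Mapping.keys x. scalar (Poly_Mapping.lookup x w) * f w)"

definition alg_hom :: "('s \<Rightarrow> 't falg) \<Rightarrow> 's falg \<Rightarrow> 't falg" where
  "alg_hom \<phi> = lin_ext (\<lambda>w. prod_list (map \<phi> w))"

text \<open>The derivation (of degree \<open>-1\<close>) with value \<open>\<delta> s\<close> on the generator \<open>s\<close> of degree \<open>dg s\<close>:
  \<open>d(s w) = (d s) w + (-1)\<^bsup>|s|\<^esup> s (d w)\<close>.\<close>

primrec word_deriv :: "('s \<Rightarrow> nat) \<Rightarrow> ('s \<Rightarrow> 's falg) \<Rightarrow> 's list \<Rightarrow> 's falg" where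
  "word_deriv dg \<delta> [] = 0"
| "word_deriv dg \<delta> (s # w) = \<delta> s * word w + (-1) ^ dg s * gen s * word_deriv dg \<delta> w"

definition derivation :: "('s \<Rightarrow> nat) \<Rightarrow> ('s \<Rightarrow> 's falg) \<Rightarrow> 's falg \<Rightarrow> 's falg" where
  "derivation dg \<delta> = lin_ext (word_deriv dg \<delta>)"

text \<open>The two-sided ideal, in a subalgebra \<open>A\<close>, generated by \<open>S \<subseteq> A\<close>.\<close>

inductive_set ideal_gen :: "'s falg set \<Rightarrow> 's falg set \<Rightarrow> 's falg set"
  for A S :: "'s falg set" where
  zero: "0 \<in> ideal_gen A S"
| add: "\<lbrakk>a \<in> A; b \<in> A; s \<in> S; x \<in> ideal_gen A S\<rbrakk> \<Longrightarrow> a * s * b + x \<in> ideal_gen A S"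


section \<open>Chain complexes and quasi-isomorphisms\<close>

text \<open>A complex of vector spaces presented by representatives: the space of \<open>k\<close>-chains is
  \<open>chains C k\<close> modulo those of its elements that lie in \<open>null C\<close>, and \<open>diff C\<close> computes the
  differential (of degree \<open>-1\<close>) on representatives. All complexes here are concentrated in
  degrees \<open>k \<ge> 0\<close>.\<close>

record 'a complex_rep =
  chains :: "nat \<Rightarrow> 'a set"
  null :: "'a set"
  diff :: "'a \<Rightarrow> 'a"

definition cycles :: "('a::ab_group_add) complex_rep \<Rightarrow> nat \<Rightarrow> 'a set" where
  "cycles C k = {z \<in> chains C k. diff C z \<in> null C}"

definition boundaries :: "('a::ab_group_add) complex_rep \<Rightarrow> nat \<Rightarrow> 'a set" where
  "boundaries C k = {b \<in> chains C k. \<exists>y\<in>chains C (Suc k). b - diff C y \<in> null C}"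

definition homologous :: "('a::ab_group_add) complex_rep \<Rightarrow> nat \<Rightarrow> ('a \<times> 'a) set" where
  "homologous C k = {(x, y). x \<in> cycles C k \<and> y \<in> cycles C k \<and> x - y \<in> boundaries C k}"

definition homology :: "('a::ab_group_add) complex_rep \<Rightarrow> nat \<Rightarrow> 'a set set" where
  "homology C k = cycles C k // homologous C k"

definition homology_map ::
  "('b::ab_group_add) complex_rep \<Rightarrow> ('a \<Rightarrow> 'b) \<Rightarrow> nat \<Rightarrow> 'a set \<Rightarrow> 'b set" where
  "homology_map D f k X = (\<Union>x\<in>X. homologous D k `` {f x})"

definition quasi_iso ::
  "('a::ab_group_add) complex_rep \<Rightarrow> ('b::ab_group_add) complex_rep \<Rightarrow> ('a \<Rightarrow> 'b) \<Rightarrow> bool" where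
  "quasi_iso C D f \<longleftrightarrow> (\<forall>k. bij_betw (homology_map D f k) (homology C k) (homology D k))"


section \<open>The graded symmetric algebra of a sum of exterior powers\<close>

text \<open>For a finite set \<open>'x\<close> of basis vectors of \<open>E\<close>, the graded symmetric algebra of
  \<open>E \<otimes> (\<Lambda>\<^sup>1V \<oplus> \<dots> \<oplus> \<Lambda>\<^sup>rV)\<close>, with \<open>\<Lambda>\<^sup>mV\<close> in degree \<open>m - 1\<close>, is presented by generators and
  relations. The generator \<open>(x, [v\<^sub>1, \<dots>, v\<^sub>m])\<close>, \<open>1 \<le> m \<le> r\<close>, stands for
  \<open>x \<otimes> \<lambda>(v\<^sub>1, \<dots>, v\<^sub>m)\<close>; the relations make it multilinear and alternating in the \<open>v\<^sub>i\<close>, and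
  make the algebra graded commutative (so squares of odd generators vanish). Generators are
  formed from all vectors, so that no basis of \<open>V\<close> has to be chosen.\<close>

definition gen_deg :: "'x \<times> 'v list \<Rightarrow> nat" where
  "gen_deg s = length (snd s) - 1"

definition gens :: "nat \<Rightarrow> ('x \<times> 'v list) set" where
  "gens r = {s. 1 \<le> length (snd s) \<and> length (snd s) \<le> r}"

definition free_on_gens :: "nat \<Rightarrow> ('x \<times> 'v list) falg set" where
  "free_on_gens r = {x. \<forall>w\<in>Poly_Mapping.keys x. set w \<subseteq> gens r}"

definition homogeneous :: "nat \<Rightarrow> nat \<Rightarrow> ('x \<times> 'v list) falg set" where
  "homogeneous r k =
    {x \<in> free_on_gens r. \<forall>w\<in>Poly_Mapping.keys x. sum_list (map gen_deg w) = k}"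

definition sym_relators ::
  "(complex \<Rightarrow> 'v::ab_group_add \<Rightarrow> 'v) \<Rightarrow> nat \<Rightarrow> ('x \<times> 'v list) falg set" where
  "sym_relators smul r =
     {gen s * gen t - (-1) ^ (gen_deg s * gen_deg t) * gen t * gen s | s t.
        s \<in> gens r \<and> t \<in> gens r}
   \<union> {gen (x, us @ (v + w) # vs) - gen (x, us @ v # vs) - gen (x, us @ w # vs) | x us v w vs.
        length us + 1 + length vs \<le> r}
   \<union> {gen (x, us @ smul c v # vs) - scalar c * gen (x, us @ v # vs) | x us c v vs.
        length us + 1 + length vs \<le> r}
   \<union> {gen (x, vs) | x vs. length vs \<le> r \<and> \<not> distinct vs}"

definition sym_ideal ::
  "(complex \<Rightarrow> 'v::ab_group_add \<Rightarrow> 'v) \<Rightarrow> nat \<Rightarrow> ('x \<times> 'v list) falg set" where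
  "sym_ideal smul r = ideal_gen (free_on_gens r) (sym_relators smul r)"


section \<open>The cobar resolution and its derived representation algebra\<close>

text \<open>In the tensor algebra \<open>R\<close> the list \<open>[v\<^sub>1, \<dots>, v\<^sub>m]\<close> stands for the generator
  \<open>\<lambda>(v\<^sub>1, \<dots>, v\<^sub>m)\<close> of degree \<open>m - 1\<close>.\<close>

definition shuffles_on :: "nat \<Rightarrow> nat \<Rightarrow> (nat \<Rightarrow> nat) set" where
  "shuffles_on p q =
    {\<sigma>. \<sigma> permutes {..<p + q} \<and> strict_mono_on {..<p} \<sigma> \<and> strict_mono_on {p..<p + q} \<sigma>}"

definition gcomm :: "'v list \<Rightarrow> 'v list \<Rightarrow> ('v list) falg" where
  "gcomm a b =
    gen a * gen b - (-1) ^ ((length a - 1) * (length b - 1)) * gen b * gen a"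

text \<open>The summand indexed by a \<open>(p, q)\<close>-shuffle with \<open>p = q\<close> does not change when the two blocks
  are exchanged. Such a pair of shuffles counts once, whence the factor \<open>1/2\<close>; this is what
  the coproduct gives, and it yields \<open>d \<lambda>(v\<^sub>1, v\<^sub>2) = - [v\<^sub>1, v\<^sub>2]\<close> and \<open>d\<^sup>2 = 0\<close>.\<close>

definition cobar_d :: "'v list \<Rightarrow> ('v list) falg" where
  "cobar_d vs = (let m = length vs in
    \<Sum>p\<in>{p. 1 \<le> p \<and> p \<le> m - p}.
      scalar (if p = m - p then 1 / 2 else 1) * (-1) ^ p *
      (\<Sum>\<sigma>\<in>shuffles_on p (m - p).
        of_int (sign \<sigma>) *
        gcomm (map (\<lambda>i. vs ! \<sigma> i) [0..<p]) (map (\<lambda>i. vs ! \<sigma> i) [p..<m])))"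

text \<open>The matrix entry \<open>(i, j)\<close> of an element of \<open>R\<close>; \<open>((i, j), a)\<close> is the generator \<open>a\<^sub>i\<^sub>j\<close>.\<close>

primrec word_entry ::
  "'n::finite \<Rightarrow> 'n \<Rightarrow> 'v list list \<Rightarrow> (('n \<times> 'n) \<times> 'v list) falg" where
  "word_entry i j [] = (if i = j then 1 else 0)"
| "word_entry i j (a # w) = (\<Sum>l\<in>UNIV. gen ((i, l), a) * word_entry l j w)"

definition entry ::
  "'n::finite \<Rightarrow> 'n \<Rightarrow> ('v list) falg \<Rightarrow> (('n \<times> 'n) \<times> 'v list) falg" where
  "entry i j = lin_ext (word_entry i j)"

definition drep_d ::
  "(('n::finite \<times> 'n) \<times> 'v list) falg \<Rightarrow> (('n \<times> 'n) \<times> 'v list) falg" where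
  "drep_d = derivation gen_deg (\<lambda>((i, j), a). entry i j (cobar_d a))"

definition DRep_Sym ::
  "(complex \<Rightarrow> 'v::ab_group_add \<Rightarrow> 'v) \<Rightarrow> nat
    \<Rightarrow> (('n::finite \<times> 'n) \<times> 'v list) falg complex_rep" where
  "DRep_Sym smul r = \<lparr>chains = homogeneous r, null = sym_ideal smul r, diff = drep_d\<rparr>"

text \<open>\<open>g \<cdot> a\<^sub>i\<^sub>j = (g\<^sup>-\<^sup>1 a g)\<^sub>i\<^sub>j\<close>.\<close>

definition GL_act ::
  "complex^'n^'n \<Rightarrow> (('n::finite \<times> 'n) \<times> 'v list) falg \<Rightarrow> (('n \<times> 'n) \<times> 'v list) falg" where
  "GL_act g = alg_hom (\<lambda>((i, j), a).
    \<Sum>k\<in>UNIV. \<Sum>l\<in>UNIV. scalar (matrix_inv g $ i $ k * g $ l $ j) * gen ((k, l), a))"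

definition DRep_Sym_GL ::
  "(complex \<Rightarrow> 'v::ab_group_add \<Rightarrow> 'v) \<Rightarrow> nat
    \<Rightarrow> (('n::finite \<times> 'n) \<times> 'v list) falg complex_rep" where
  "DRep_Sym_GL smul r = (DRep_Sym smul r)\<lparr>chains := \<lambda>k.
    {x \<in> homogeneous r k. \<forall>g::complex^'n^'n. invertible g \<longrightarrow>
       GL_act g x - x \<in> sym_ideal smul r}\<rparr>"


section \<open>The derived Harish-Chandra homomorphism\<close>

text \<open>Here \<open>(i, a)\<close> is the generator \<open>e\<^sup>i \<otimes> a\<close>.\<close>

definition Sn_act :: "('n \<Rightarrow> 'n) \<Rightarrow> ('n \<times> 'v list) falg \<Rightarrow> ('n \<times> 'v list) falg" where
  "Sn_act \<pi> = alg_hom (\<lambda>(i, a). gen (\<pi> i, a))"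

definition Sym_cartan_Sn ::
  "(complex \<Rightarrow> 'v::ab_group_add \<Rightarrow> 'v) \<Rightarrow> nat
    \<Rightarrow> ('n::finite \<times> 'v list) falg complex_rep" where
  "Sym_cartan_Sn smul r =
    \<lparr>chains = \<lambda>k. {x \<in> homogeneous r k. \<forall>\<pi>. \<pi> permutes (UNIV :: 'n set) \<longrightarrow>
        Sn_act \<pi> x - x \<in> sym_ideal smul r},
     null = sym_ideal smul r,
     diff = (\<lambda>_. 0)\<rparr>"

definition harish_chandra ::
  "(('n::finite \<times> 'n) \<times> 'v list) falg \<Rightarrow> ('n \<times> 'v list) falg" where
  "harish_chandra = alg_hom (\<lambda>((i, j), a). if i = j then gen (i, a) else 0)"

end

theory Submission
  imports Defs
begin

text \<open>The map induced on degree 1 homology is not surjective: it misses the class of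
  \<open>\<Sum>\<^sub>i x\<^sub>i \<lambda>(y,z)\<^sub>i + y\<^sub>i \<lambda>(z,x)\<^sub>i + z\<^sub>i \<lambda>(x,y)\<^sub>i\<close> for linearly independent \<open>x, y, z\<close>. The part of a degree 1
  chain that is linear in the degree 0 generators and linear in the degree 1 generators is a
  collection of conjugation-invariant bilinear forms on \<open>n \<times> n\<close> matrices, one for each pair of a
  generator in \<open>V\<close> and one in \<open>\<Lambda>\<^sup>2V\<close>. If the chain restricts to the above class on diagonal
  matrices, invariance under elementary matrices forces the forms that matter to agree with
  \<open>tr (x \<lambda>(y,z)) + tr (y \<lambda>(z,x)) + tr (z \<lambda>(x,y))\<close>, whose differential is
  \<open>- 3 tr (x [y,z])\<close>. This is nonzero at \<open>x = E\<^sub>a\<^sub>a\<close>, \<open>y = E\<^sub>a\<^sub>b\<close>, \<open>z = E\<^sub>b\<^sub>a\<close>, so the chain is not a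
  cycle. All computations in the quotient by the ideal of relations are made with explicit linear
  functionals on the free algebra that vanish on the ideal.\<close>


section \<open>Linear functionals on the free algebra\<close>

definition functional :: "('s list \<Rightarrow> complex) \<Rightarrow> 's falg \<Rightarrow> complex" where
  "functional F x = (\<Sum>w\<in>Poly_Mapping.keys x. Poly_Mapping.lookup x w * F w)"

lemma functional_superset:
  assumes "finite A" "Poly_Mapping.keys x \<subseteq> A"
  shows "functional F x = (\<Sum>w\<in>A. Poly_Mapping.lookup x w * F w)"
  unfolding functional_def using assms
  by (intro sum.mono_neutral_left) (auto simp: in_keys_iff)

lemma functional_zero [simp]: "functional F 0 = 0"
  by (simp add: functional_def)

lemma functional_single [simp]: "functional F (Poly_Mapping.single w c) = c * F w"
  by (simp add: functional_def)

lemma functional_word [simp]: "functional F (word w) = F w"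
  by (simp add: word_def)

lemma functional_gen [simp]: "functional F (gen s) = F [s]"
  by (simp add: gen_def)

lemma functional_add [simp]: "functional F (x + y) = functional F x + functional F y"
proof -
  let ?A = "Poly_Mapping.keys x \<union> Poly_Mapping.keys y"
  have "functional F (x + y) = (\<Sum>w\<in>?A. Poly_Mapping.lookup (x + y) w * F w)"
    by (intro functional_superset) (auto simp: Poly_Mapping.keys_add)
  moreover have "functional F x = (\<Sum>w\<in>?A. Poly_Mapping.lookup x w * F w)"
    by (intro functional_superset) auto
  moreover have "functional F y = (\<Sum>w\<in>?A. Poly_Mapping.lookup y w * F w)"
    by (intro functional_superset) auto
  ultimately show ?thesis
    by (simp add: lookup_add algebra_simps sum.distrib)
qed

lemma functional_uminus [simp]: "functional F (- x) = - functional F x"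
  by (simp add: functional_def sum_negf)

lemma functional_diff [simp]: "functional F (x - y) = functional F x - functional F y"
  using functional_add [of F x "- y"] by simp

lemma functional_sum [simp]: "functional F (sum f A) = (\<Sum>a\<in>A. functional F (f a))"
  by (induction A rule: infinite_finite_induct) auto

lemma functional_const_zero [simp]: "functional (\<lambda>w. 0) x = 0"
  by (simp add: functional_def)

lemma falg_decompose:
  fixes x :: "'s falg"
  shows "x = (\<Sum>w\<in>Poly_Mapping.keys x. Poly_Mapping.single w (Poly_Mapping.lookup x w))"
  by (rule poly_mapping_eqI) (simp add: lookup_sum lookup_single when_def in_keys_iff)

lemma functional_mult:
  "functional F (a * b) = (\<Sum>u\<in>Poly_Mapping.keys a. \<Sum>w\<in>Poly_Mapping.keys b.
     Poly_Mapping.lookup a u * Poly_Mapping.lookup b w * F (u @ w))"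
proof -
  have "functional F (a * b) = functional F
     ((\<Sum>w\<in>Poly_Mapping.keys a. Poly_Mapping.single w (Poly_Mapping.lookup a w)) *
      (\<Sum>w\<in>Poly_Mapping.keys b. Poly_Mapping.single w (Poly_Mapping.lookup b w)))"
    using falg_decompose [of a] falg_decompose [of b] by simp
  then show ?thesis
    by (simp add: sum_product mult_single plus_list_def)
qed

text \<open>Fixing the word of one factor leaves a functional on the other. With the mirrored
  version below, this peels the outer factors off a product \<open>a * s * b\<close> in a two-sided
  ideal.\<close>

lemma functional_mult_left:
  "functional F (a * b) =
     (\<Sum>u\<in>Poly_Mapping.keys a. Poly_Mapping.lookup a u * functional (\<lambda>w. F (u @ w)) b)"
  unfolding functional_mult functional_def [of _ b]
  by (simp add: sum_distrib_left mult.assoc)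

lemma functional_mult_right:
  "functional F (a * b) =
     (\<Sum>w\<in>Poly_Mapping.keys b. Poly_Mapping.lookup b w * functional (\<lambda>u. F (u @ w)) a)"
  unfolding functional_mult functional_def [of _ a]
  by (subst sum.swap) (simp add: sum_distrib_left mult_ac)

lemma functional_scalar_mult [simp]: "functional F (scalar c * x) = c * functional F x"
  by (cases "c = 0") (simp_all add: functional_mult_left scalar_def)

lemma scalar_one: "scalar 1 = 1"
  by (simp add: scalar_def zero_list_def [symmetric])

lemma scalar_add: "scalar (c + d) = scalar c + scalar d"
  by (simp add: scalar_def single_add)

lemma scalar_uminus: "scalar (- c) = - scalar c"
  by (simp add: scalar_def single_uminus)

lemma scalar_of_int: "scalar (of_int k) = of_int k"
  by (simp add: scalar_def zero_list_def [symmetric])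

lemma scalar_minus_one_power: "scalar ((-1) ^ n) = (-1) ^ n"
  by (induction n) (simp_all add: scalar_one scalar_uminus)

lemma functional_minus_one_power_mult [simp]:
  "functional F ((-1) ^ n * x) = (-1) ^ n * functional F x"
  by (simp flip: scalar_minus_one_power)

lemma functional_of_int_mult [simp]: "functional F (of_int k * x) = of_int k * functional F x"
  by (simp flip: scalar_of_int)

lemma functional_lin_ext:
  "functional F (lin_ext f x) = functional (\<lambda>w. functional F (f w)) x"
  by (simp add: lin_ext_def functional_def [of "\<lambda>w. functional F (f w)"])

lemma word_append: "word (u @ w) = word u * word w"
  by (simp add: word_def mult_single plus_list_def)

lemma word_Nil: "word [] = 1"
  by (simp add: word_def zero_list_def [symmetric])

lemma gen_mult_gen: "gen s * gen t = word [s, t]"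
  by (simp add: gen_def flip: word_append)

text \<open>A character of the monoid of words extends to an algebra homomorphism to the complex
  numbers: this is evaluation of the generators at a point.\<close>

lemma functional_multiplicative:
  assumes "\<And>u w. F (u @ w) = F u * F w"
  shows "functional F (a * b) = functional F a * functional F b"
  by (simp add: functional_mult assms) (simp add: functional_def sum_product mult_ac)

lemma lin_ext_word: "lin_ext f (word w) = f w"
  by (simp add: lin_ext_def word_def scalar_one)

lemma lin_ext_add: "lin_ext f (x + y) = lin_ext f x + lin_ext f y"
proof -
  let ?A = "Poly_Mapping.keys x \<union> Poly_Mapping.keys y"
  have eq: "lin_ext f z = (\<Sum>w\<in>?A. scalar (Poly_Mapping.lookup z w) * f w)"
    if "Poly_Mapping.keys z \<subseteq> ?A" for z
    unfolding lin_ext_def using that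
    by (intro sum.mono_neutral_left) (auto simp: in_keys_iff scalar_def)
  show ?thesis
    by (simp add: scalar_add eq Poly_Mapping.keys_add lookup_add algebra_simps sum.distrib)
qed

lemma lin_ext_sum: "lin_ext f (sum g A) = (\<Sum>a\<in>A. lin_ext f (g a))"
proof (induction A rule: infinite_finite_induct)
qed (simp_all add: lin_ext_add, simp_all add: lin_ext_def)

section \<open>Grading of the free algebra by word length\<close>

definition len_hom :: "nat \<Rightarrow> 's falg \<Rightarrow> bool" where
  "len_hom k x \<longleftrightarrow> (\<forall>w\<in>Poly_Mapping.keys x. length w = k)"

lemma len_hom_zero [simp]: "len_hom k 0"
  by (simp add: len_hom_def)

lemma len_hom_add: "len_hom k x \<Longrightarrow> len_hom k y \<Longrightarrow> len_hom k (x + y)"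
  using Poly_Mapping.keys_add [of x y] by (auto simp: len_hom_def)

lemma len_hom_diff: "len_hom k x \<Longrightarrow> len_hom k y \<Longrightarrow> len_hom k (x - y)"
  using keys_diff [of x y] by (auto simp: len_hom_def)

lemma len_hom_sum: "(\<And>a. a \<in> A \<Longrightarrow> len_hom k (f a)) \<Longrightarrow> len_hom k (sum f A)"
  by (induction A rule: infinite_finite_induct) (auto intro: len_hom_add)

lemma len_hom_mult: "len_hom k x \<Longrightarrow> len_hom l y \<Longrightarrow> len_hom (k + l) (x * y)"
  using keys_mult [of x y] by (fastforce simp: len_hom_def plus_list_def)

lemma len_hom_word: "len_hom (length w) (word w)"
  by (simp add: len_hom_def word_def)

lemma len_hom_gen: "len_hom 1 (gen s)"
  using len_hom_word [of "[s]"] by (simp add: gen_def)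

lemma len_hom_scalar: "len_hom 0 (scalar c)"
  by (simp add: len_hom_def scalar_def)

lemma len_hom_scalar_mult: "len_hom k x \<Longrightarrow> len_hom k (scalar c * x)"
  using len_hom_mult [OF len_hom_scalar] by fastforce

lemma len_hom_minus_one_power_mult: "len_hom k x \<Longrightarrow> len_hom k ((-1) ^ n * x)"
  by (simp add: len_hom_scalar_mult flip: scalar_minus_one_power)

lemma len_hom_of_int_mult: "len_hom k x \<Longrightarrow> len_hom k (of_int n * x)"
  by (simp add: len_hom_scalar_mult flip: scalar_of_int)

lemma len_hom_lin_ext:
  "(\<And>w. w \<in> Poly_Mapping.keys x \<Longrightarrow> len_hom k (f w)) \<Longrightarrow> len_hom k (lin_ext f x)"
  unfolding lin_ext_def by (intro len_hom_sum len_hom_scalar_mult) auto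

lemma functional_cong_len:
  assumes "len_hom k x" "\<And>w. length w = k \<Longrightarrow> F w = G w"
  shows "functional F x = functional G x"
  using assms by (simp add: functional_def len_hom_def)

lemma functional_eq_0_len:
  assumes "len_hom k x" "\<And>w. length w = k \<Longrightarrow> F w = 0"
  shows "functional F x = 0"
  using functional_cong_len [of k x F "\<lambda>w. 0"] assms by simp


section \<open>Functionals vanishing on the ideal of relations\<close>

text \<open>Expanding the outer factors into words reduces vanishing on the ideal to vanishing on
  \<open>u * s * w\<close> for words \<open>u\<close>, \<open>w\<close> and a relator
  \<open>s\<close>. Each hypothesis after the first treats one family of relators in such a
  context.\<close>

lemma functional_sym_ideal:
  assumes x: "x \<in> sym_ideal smul r"
    and comm: "\<And>u w s t. s \<in> gens r \<Longrightarrow> t \<in> gens r \<Longrightarrow>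
      F (u @ s # t # w) = (-1) ^ (gen_deg s * gen_deg t) * F (u @ t # s # w)"
    and add: "\<And>u w i us v v' vs. F (u @ (i, us @ (v + v') # vs) # w) =
      F (u @ (i, us @ v # vs) # w) + F (u @ (i, us @ v' # vs) # w)"
    and scale: "\<And>u w i us c v vs. F (u @ (i, us @ smul c v # vs) # w) =
      c * F (u @ (i, us @ v # vs) # w)"
    and alt: "\<And>u w i vs. \<not> distinct vs \<Longrightarrow> F (u @ (i, vs) # w) = 0"
  shows "functional F x = 0"
  using x unfolding sym_ideal_def
proof (induction rule: ideal_gen.induct)
  case (add a b s x)
  have "functional (\<lambda>v. F (u @ v @ w)) s = 0" for u w
    using add.hyps(3) unfolding sym_relators_def
  proof (elim UnE)
    assume "s \<in> {gen s * gen t - (-1) ^ (gen_deg s * gen_deg t) * gen t * gen s | s t.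
      s \<in> gens r \<and> t \<in> gens r}"
    then obtain p q where "s = word [p, q] - (-1) ^ (gen_deg p * gen_deg q) * word [q, p]"
      and "p \<in> gens r" "q \<in> gens r"
      by (auto simp: gen_mult_gen mult.assoc)
    with comm [of p q u w] show ?thesis
      by simp
  qed (auto simp: assms(3) scale alt)
  then have "functional F (a * s * b) = 0"
    by (simp add: functional_mult_right [of F "a * s"] functional_mult_left [of _ a s])
  with add.IH show ?case
    by simp
qed simp

section \<open>Functionals evaluating the generators at points\<close>

definition alt_multilinear ::
  "(complex \<Rightarrow> 'v::ab_group_add \<Rightarrow> 'v) \<Rightarrow> ('x \<times> 'v list \<Rightarrow> complex) \<Rightarrow> bool" where
  "alt_multilinear smul P \<longleftrightarrow>
     (\<forall>x us v w vs. P (x, us @ (v + w) # vs) = P (x, us @ v # vs) + P (x, us @ w # vs)) \<and>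
     (\<forall>x us c v vs. P (x, us @ smul c v # vs) = c * P (x, us @ v # vs)) \<and>
     (\<forall>x vs. \<not> distinct vs \<longrightarrow> P (x, vs) = 0)"

definition letter :: "('s \<Rightarrow> complex) \<Rightarrow> 's list \<Rightarrow> complex" where
  "letter P w = (case w of [s] \<Rightarrow> P s | _ \<Rightarrow> 0)"

text \<open>On two-letter words this is the mixed term of the evaluation at a point: the coefficient
  of \<open>e * d\<close> when each letter is evaluated at \<open>e * P + d * Q\<close>.\<close>

definition pairing :: "('s \<Rightarrow> complex) \<Rightarrow> ('s \<Rightarrow> complex) \<Rightarrow> 's list \<Rightarrow> complex" where
  "pairing P Q w = (case w of [s, t] \<Rightarrow> P s * Q t + Q s * P t | _ \<Rightarrow> 0)"

definition cubic :: "('s \<Rightarrow> complex) \<Rightarrow> 's list \<Rightarrow> complex" where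
  "cubic P w = (if length w = 3 then prod_list (map P w) else 0)"

lemma letter_simps [simp]: "letter P [s] = P s"
  by (simp add: letter_def)

lemma pairing_simps [simp]: "pairing P Q [s, t] = P s * Q t + Q s * P t"
  by (simp add: pairing_def)

lemma pairing_eq_0: "length w \<noteq> 2 \<Longrightarrow> pairing P Q w = 0"
  by (auto simp: pairing_def split: list.split)

text \<open>As a function of one letter in a fixed context, the pairing is a combination of
  \<open>P\<close> and \<open>Q\<close>, so it inherits any linear relation that both
  satisfy.\<close>

lemma pairing_letter_linear:
  obtains c d where "\<And>s. pairing P Q (u @ s # w) = P s * c + Q s * d"
proof -
  consider t where "u = []" "w = [t]" | t where "u = [t]" "w = []" | "length u + length w \<noteq> 1"
    by (cases u; cases w) auto
  then show ?thesis
  proof cases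
    case 1
    then show ?thesis using that [of "Q t" "P t"] by simp
  next
    case 2
    then show ?thesis using that [of "Q t" "P t"] by simp
  next
    case 3
    then show ?thesis using that [of 0 0] by (simp add: pairing_eq_0)
  qed
qed

text \<open>The pairing is symmetric, whereas graded commutativity asks for a sign when both letters
  are odd. Since \<open>P\<close> lives in degree 0, the pairing is zero on two odd letters and the
  sign does no harm.\<close>

lemma functional_pairing_sym_ideal:
  fixes P Q :: "'x \<times> 'v::ab_group_add list \<Rightarrow> complex"
  assumes x: "x \<in> sym_ideal smul r"
    and P: "alt_multilinear smul P" and Q: "alt_multilinear smul Q"
    and degP: "\<And>s. P s \<noteq> 0 \<Longrightarrow> gen_deg s = 0"
  shows "functional (pairing P Q) x = 0"
proof (rule functional_sym_ideal [OF x])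
  fix u w :: "('x \<times> 'v list) list" and s t
  have "P s = 0 \<or> gen_deg s = 0"
    using degP [of s] by (cases "P s = 0") simp_all
  moreover have "P t = 0 \<or> gen_deg t = 0"
    using degP [of t] by (cases "P t = 0") simp_all
  ultimately show "pairing P Q (u @ s # t # w) =
      (-1) ^ (gen_deg s * gen_deg t) * pairing P Q (u @ t # s # w)"
    by (cases u; cases w) (auto simp: pairing_eq_0)
next
  fix u w :: "('x \<times> 'v list) list" and i us v v' vs
  obtain c d where "\<And>s. pairing P Q (u @ s # w) = P s * c + Q s * d"
    using pairing_letter_linear [of P Q u w] by metis
  then show "pairing P Q (u @ (i, us @ (v + v') # vs) # w) =
      pairing P Q (u @ (i, us @ v # vs) # w) + pairing P Q (u @ (i, us @ v' # vs) # w)"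
    using P Q by (simp add: alt_multilinear_def algebra_simps)
next
  fix u w :: "('x \<times> 'v list) list" and i us c v vs
  obtain a b where "\<And>s. pairing P Q (u @ s # w) = P s * a + Q s * b"
    using pairing_letter_linear [of P Q u w] by metis
  then show "pairing P Q (u @ (i, us @ smul c v # vs) # w) =
      c * pairing P Q (u @ (i, us @ v # vs) # w)"
    using P Q by (simp add: alt_multilinear_def algebra_simps)
next
  fix u w :: "('x \<times> 'v list) list" and i vs
  obtain a b where "\<And>s. pairing P Q (u @ s # w) = P s * a + Q s * b"
    using pairing_letter_linear [of P Q u w] by metis
  then show "pairing P Q (u @ (i, vs) # w) = 0" if "\<not> distinct vs"
    using P Q that by (simp add: alt_multilinear_def)
qed

lemma functional_cubic_sym_ideal:
  fixes P :: "'x \<times> 'v::ab_group_add list \<Rightarrow> complex"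
  assumes x: "x \<in> sym_ideal smul r"
    and P: "alt_multilinear smul P" and degP: "\<And>s. P s \<noteq> 0 \<Longrightarrow> gen_deg s = 0"
  shows "functional (cubic P) x = 0"
proof (rule functional_sym_ideal [OF x])
  fix u w :: "('x \<times> 'v list) list" and s t
  have "P s = 0 \<or> gen_deg s = 0"
    using degP [of s] by (cases "P s = 0") simp_all
  then show "cubic P (u @ s # t # w) =
      (-1) ^ (gen_deg s * gen_deg t) * cubic P (u @ t # s # w)"
    by (auto simp: cubic_def)
qed (use P in \<open>auto simp: cubic_def alt_multilinear_def algebra_simps\<close>)

lemma len_hom_prod_list_map:
  "(\<And>s. len_hom 1 (\<phi> s)) \<Longrightarrow> len_hom (length w) (prod_list (map \<phi> w))"
proof (induction w)
  case Nil
  show ?case using len_hom_scalar [of 1] by (simp add: scalar_one)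
next
  case (Cons s w)
  then show ?case using len_hom_mult [of 1 "\<phi> s" "length w"] by simp
qed

lemma functional_pairing_mult:
  assumes a: "len_hom 1 a" and b: "len_hom 1 b"
  shows "functional (pairing P Q) (a * b) =
    functional (letter P) a * functional (letter Q) b +
    functional (letter Q) a * functional (letter P) b"
proof -
  have "pairing P Q (u @ w) = letter P u * letter Q w + letter Q u * letter P w"
    if "u \<in> Poly_Mapping.keys a" "w \<in> Poly_Mapping.keys b" for u w
    using that a b by (force simp: len_hom_def length_Suc_conv)
  then have "functional (pairing P Q) (a * b) =
      (\<Sum>u\<in>Poly_Mapping.keys a. \<Sum>w\<in>Poly_Mapping.keys b.
        (Poly_Mapping.lookup a u * letter P u) * (Poly_Mapping.lookup b w * letter Q w) +
        (Poly_Mapping.lookup a u * letter Q u) * (Poly_Mapping.lookup b w * letter P w))"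
    unfolding functional_mult by (intro sum.cong refl) (simp add: algebra_simps)
  then show ?thesis
    by (simp only: sum.distrib functional_def sum_product)
qed

text \<open>A linear substitution of generators preserves word length, so the pairing pulls back to
  the pairing of the pulled-back valuations. This serves both the conjugation action and the
  restriction to diagonal matrices.\<close>

lemma functional_pairing_alg_hom:
  assumes \<phi>: "\<And>s. len_hom 1 (\<phi> s)"
  shows "functional (pairing P Q) (alg_hom \<phi> x) =
    functional (pairing (\<lambda>s. functional (letter P) (\<phi> s)) (\<lambda>s. functional (letter Q) (\<phi> s))) x"
proof -
  have "functional (pairing P Q) (prod_list (map \<phi> w)) =
      pairing (\<lambda>s. functional (letter P) (\<phi> s)) (\<lambda>s. functional (letter Q) (\<phi> s)) w" for w
  proof (cases "length w = 2")
    case True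
    then obtain s t where "w = [s, t]"
      by (auto simp: length_Suc_conv numeral_2_eq_2)
    then show ?thesis
      by (simp add: functional_pairing_mult [OF \<phi> \<phi>])
  next
    case False
    then show ?thesis
      using functional_eq_0_len [OF len_hom_prod_list_map [OF \<phi>, of w], where F = "pairing P Q"]
      by (simp add: pairing_eq_0)
  qed
  then show ?thesis
    by (simp add: alg_hom_def functional_lin_ext)
qed


section \<open>The differential on words of two letters\<close>

lemma len_hom_cobar_d: "len_hom 2 (cobar_d vs)"
proof -
  have "len_hom 2 (gcomm a b)" for a b :: "'a list"
    using len_hom_word [of "[a, b]"] len_hom_word [of "[b, a]"]
    by (simp add: gcomm_def mult.assoc gen_mult_gen len_hom_diff len_hom_minus_one_power_mult
      numeral_2_eq_2)
  then show ?thesis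
    by (auto simp: cobar_d_def Let_def mult.assoc intro!: len_hom_sum len_hom_scalar_mult
      len_hom_minus_one_power_mult len_hom_of_int_mult)
qed

lemma cobar_d_singleton: "cobar_d [v] = 0"
proof -
  have "{p. 1 \<le> p \<and> p \<le> length [v] - p} = {}"
    by auto
  then show ?thesis
    unfolding cobar_d_def Let_def by (simp only: sum.empty)
qed

lemma shuffles_on_1_1: "shuffles_on 1 1 = {id, Transposition.transpose 0 1}"
proof -
  have "{..<1 + 1} = {0, 1::nat}"
    by auto
  moreover have "strict_mono_on {..<1::nat} \<sigma>" "strict_mono_on {1..<1 + 1::nat} \<sigma>"
    for \<sigma> :: "nat \<Rightarrow> nat"
    by (auto simp: strict_mono_on_def)
  ultimately show ?thesis
    by (auto simp: shuffles_on_def permutes_doubleton_iff)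
qed

text \<open>The two (1,1)-shuffles contribute the same commutator, because the sign of the
  transposition cancels the antisymmetry of the bracket; the factor 1/2 turns the pair into a single
  \<open>- [v, w]\<close>.\<close>

lemma functional_cobar_d_pair: "functional F (cobar_d [v, w]) = F [[w], [v]] - F [[v], [w]]"
proof -
  have "id \<noteq> Transposition.transpose 0 (1::nat)"
    by (metis id_apply transpose_apply_first zero_neq_one)
  have "{p. 1 \<le> p \<and> p \<le> length [v, w] - p} = {1}"
    by auto
  then have "cobar_d [v, w] = scalar (1 / 2) * (-1) ^ 1 * (\<Sum>\<sigma>\<in>shuffles_on 1 1.
      of_int (sign \<sigma>) * gcomm [[v, w] ! \<sigma> 0] [[v, w] ! \<sigma> 1])"
    unfolding cobar_d_def Let_def by (simp add: upt_conv_Cons)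
  also have "\<dots> = scalar (1 / 2) * (-1) ^ 1 *
      (of_int 1 * gcomm [v] [w] + of_int (-1) * gcomm [w] [v])"
    using \<open>id \<noteq> Transposition.transpose 0 (1::nat)\<close>
    by (subst shuffles_on_1_1, subst sum.insert) (auto simp: sign_swap_id)
  finally show ?thesis
    by (simp only: mult.assoc functional_scalar_mult functional_minus_one_power_mult
      functional_add functional_of_int_mult)
      (simp add: gcomm_def gen_mult_gen)
qed

lemma len_hom_word_entry: "len_hom (length w) (word_entry i j w)"
proof (induction w arbitrary: i)
  case Nil
  show ?case using len_hom_scalar [of 1] by (auto simp: scalar_one)
next
  case (Cons a w)
  then show ?case
    by (auto intro!: len_hom_sum len_hom_mult [OF len_hom_gen, simplified])
qed

lemma len_hom_entry: "len_hom k x \<Longrightarrow> len_hom k (entry i j x)"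
  unfolding entry_def
  by (intro len_hom_lin_ext) (metis len_hom_def len_hom_word_entry)

lemma len_hom_word_deriv:
  assumes "\<And>s. len_hom 2 (\<delta> s)"
  shows "len_hom (Suc (length w)) (word_deriv dg \<delta> w)"
proof (induction w)
  case (Cons s w)
  have "len_hom (2 + length w) (\<delta> s * word w)"
    using assms by (intro len_hom_mult len_hom_word)
  moreover have "len_hom (1 + Suc (length w)) (gen s * word_deriv dg \<delta> w)"
    using Cons by (intro len_hom_mult len_hom_gen)
  ultimately show ?case
    by (simp add: mult.assoc len_hom_add len_hom_minus_one_power_mult)
qed simp

text \<open>With X(v) the matrix of numbers \<open>P ((i, j), [v])\<close>, this is the entry
  \<open>(i, j)\<close> of the commutator of X(v) and X(w), extended by zero to a valuation of all
  generators.\<close>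

definition commutator_val ::
  "(('n::finite \<times> 'n) \<times> 'v list \<Rightarrow> complex) \<Rightarrow> ('n \<times> 'n) \<times> 'v list \<Rightarrow> complex" where
  "commutator_val P = (\<lambda>((i, j), a). case a of
     [v, w] \<Rightarrow> (\<Sum>l\<in>UNIV. P ((i, l), [v]) * P ((l, j), [w]) - P ((i, l), [w]) * P ((l, j), [v]))
   | _ \<Rightarrow> 0)"

lemma functional_entry_pair:
  fixes P :: "('n::finite \<times> 'n) \<times> 'v list \<Rightarrow> complex"
  shows "functional (\<lambda>w. prod_list (map P w)) (entry i j (cobar_d [v, w])) =
    - commutator_val P ((i, j), [v, w])"
proof -
  let ?H = "\<lambda>w. prod_list (map P w)"
  have mult: "functional ?H (x * y) = functional ?H x * functional ?H y" for x y
    by (rule functional_multiplicative) simp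
  have one: "functional ?H 1 = 1"
    using functional_word [of ?H "[]"] by (simp add: word_Nil)
  have "functional ?H (word_entry i j [a, b]) = (\<Sum>l\<in>UNIV. P ((i, l), a) * P ((l, j), b))" for a b
    by (simp add: mult one if_distrib [of "functional ?H"] if_distrib [of "(*) _"] cong: if_cong)
  then show ?thesis
    by (simp add: entry_def functional_lin_ext functional_cobar_d_pair commutator_val_def
      sum_subtractf del: word_entry.simps)
qed

text \<open>A two-letter word of degree 1 has one letter of degree 0, which the differential kills,
  and one of degree 1, which it sends to minus a commutator. Evaluating the differential at
  \<open>P\<close> thus amounts to evaluating the degree 1 letter at the commutators of
  \<open>P\<close>.\<close>

lemma functional_cubic_drep_d:
  fixes P :: "('n::finite \<times> 'n) \<times> 'v list \<Rightarrow> complex"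
  assumes c: "c \<in> homogeneous r 1" and P: "\<And>s. length (snd s) \<noteq> 1 \<Longrightarrow> P s = 0"
  shows "functional (cubic P) (drep_d c) = - functional (pairing P (commutator_val P)) c"
proof -
  define \<delta> :: "('n \<times> 'n) \<times> 'v list \<Rightarrow> (('n \<times> 'n) \<times> 'v list) falg"
    where "\<delta> = (\<lambda>((i, j), a). entry i j (cobar_d a))"
  let ?H = "\<lambda>w. prod_list (map P w)"
  have mult: "functional ?H (x * y) = functional ?H x * functional ?H y" for x y
    by (rule functional_multiplicative) simp
  have \<delta>: "len_hom 2 (\<delta> s)" for s
    by (auto simp: \<delta>_def len_hom_entry len_hom_cobar_d split: prod.split)
  have "functional (cubic P) (word_deriv gen_deg \<delta> w) = - pairing P (commutator_val P) w"
    if "w \<in> Poly_Mapping.keys c" for w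
  proof (cases "length w = 2")
    case False
    then show ?thesis
      using functional_eq_0_len [OF len_hom_word_deriv [OF \<delta>, of w], where F = "cubic P"]
      by (simp add: pairing_eq_0 cubic_def)
  next
    case True
    then obtain s t where w: "w = [s, t]"
      by (auto simp: length_Suc_conv numeral_2_eq_2)
    have st: "s \<in> gens r" "t \<in> gens r" "gen_deg s + gen_deg t = 1"
      using c that by (auto simp: homogeneous_def free_on_gens_def w)
    \<comment> \<open>The differential of a two-letter word has length 3, where
      \<open>cubic P\<close> agrees with the multiplicative \<open>?H\<close>.\<close>
    have "functional (cubic P) (word_deriv gen_deg \<delta> w) = functional ?H (word_deriv gen_deg \<delta> w)"
      using functional_cong_len [OF len_hom_word_deriv [OF \<delta>, of w], of "cubic P" ?H] True
      by (simp add: cubic_def)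
    also have "\<dots> = functional ?H (\<delta> s) * P t + (-1) ^ gen_deg s * (P s * functional ?H (\<delta> t))"
      by (simp add: w mult.assoc word_Nil) (simp add: mult)
    also have "\<dots> = - pairing P (commutator_val P) w"
    proof -
      obtain i j a where s: "s = ((i, j), a)" by (metis surj_pair)
      obtain k l b where t: "t = ((k, l), b)" by (metis surj_pair)
      have *: "functional ?H (\<delta> ((i, j), [p])) = 0" "commutator_val P ((i, j), [p]) = 0" for i j p
        by (simp_all add: \<delta>_def cobar_d_singleton entry_def lin_ext_def commutator_val_def)
      have **: "functional ?H (\<delta> ((i, j), [p, q])) = - commutator_val P ((i, j), [p, q])" for i j p q
        by (simp add: \<delta>_def functional_entry_pair)
      \<comment> \<open>Membership in \<open>gens r\<close> excludes empty lists, on which the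
        truncated \<open>length - 1\<close> would also give degree 0.\<close>
      have "length a = 1 \<and> length b = 2 \<or> length a = 2 \<and> length b = 1"
        using st by (auto simp: s t gens_def gen_deg_def)
      then consider p q q' where "a = [p]" "b = [q, q']" | p q q' where "a = [q, q']" "b = [p]"
        by (auto simp: length_Suc_conv numeral_2_eq_2)
      then show ?thesis
        by cases (simp_all add: w s t * ** P gen_deg_def)
    qed
    finally show ?thesis .
  qed
  then show ?thesis
    by (simp add: drep_d_def derivation_def functional_lin_ext \<delta>_def [symmetric])
      (simp add: functional_def sum_negf)
qed


section \<open>Conjugation-invariant bilinear forms\<close>

definition matrix_unit :: "'n \<Rightarrow> 'n \<Rightarrow> 'n \<times> 'n \<Rightarrow> complex" where
  "matrix_unit a b = (\<lambda>(i, j). of_bool (i = a \<and> j = b))"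

text \<open>\<open>(1 + s E\<^sub>a\<^sub>b) m (1 + t E\<^sub>a\<^sub>b)\<close>\<close>

definition elem_conj ::
  "'n \<Rightarrow> 'n \<Rightarrow> complex \<Rightarrow> complex \<Rightarrow> ('n \<times> 'n \<Rightarrow> complex) \<Rightarrow> 'n \<times> 'n \<Rightarrow> complex" where
  "elem_conj a b s t m = (\<lambda>(i, j). m (i, j) + of_bool (i = a) * s * m (b, j) +
     of_bool (j = b) * t * m (i, a) + of_bool (i = a \<and> j = b) * s * t * m (b, a))"

text \<open>Invariant bilinear forms are spanned by tr(mn) and tr(m) tr(n), and the values on
  diagonal units leave only \<kappa> tr(mn). The values used here come directly from two kinds of
  conjugation: diagonal ones force the vanishing, and a unipotent one links off-diagonal units to
  diagonal ones.\<close>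

lemma invariant_form_values:
  fixes \<beta> :: "('n \<times> 'n \<Rightarrow> complex) \<Rightarrow> ('n \<times> 'n \<Rightarrow> complex) \<Rightarrow> complex"
  assumes add_left: "\<And>m m' n. \<beta> (\<lambda>x. m x + m' x) n = \<beta> m n + \<beta> m' n"
    and add_right: "\<And>m n n'. \<beta> m (\<lambda>x. n x + n' x) = \<beta> m n + \<beta> m n'"
    and scale_left: "\<And>u m n. \<beta> (\<lambda>x. u * m x) n = u * \<beta> m n"
    and scale_right: "\<And>u m n. \<beta> m (\<lambda>x. u * n x) = u * \<beta> m n"
    and inv: "\<And>a b s t m n. s + t + of_bool (a = b) * s * t = 0 \<Longrightarrow>
      \<beta> (elem_conj a b s t m) (elem_conj a b s t n) = \<beta> m n"
    and diag: "\<And>a b. \<beta> (matrix_unit a a) (matrix_unit b b) = of_bool (a = b) * \<kappa>"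
    and ab: "a \<noteq> b"
  shows "\<beta> (matrix_unit a b) (matrix_unit b a) = \<kappa>"
    and "\<beta> (matrix_unit a b) (matrix_unit a b) = 0"
    and "\<beta> (matrix_unit a b) (matrix_unit d d) = 0"
    and "\<beta> (matrix_unit d d) (matrix_unit a b) = 0"
proof -
  \<comment> \<open>For \<open>a = b = p\<close>, the scalars 1 and -1/2 give the diagonal matrices
    with entry 2, respectively 1/2, at \<open>p\<close>, which are mutually inverse. Eigenvectors
    whose eigenvalues do not multiply to 1 pair to zero.\<close>
  have torus: "\<beta> m n = 0" if "elem_conj p p 1 (-1/2) m = (\<lambda>x. u * m x)"
    "elem_conj p p 1 (-1/2) n = (\<lambda>x. v * n x)" "u * v \<noteq> 1" for p m n u v
    using inv [of 1 "-1/2" p p m n] that by (simp add: scale_left scale_right)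
  have ab2: "elem_conj p p 1 (-1/2) (matrix_unit p q) = (\<lambda>x. 2 * matrix_unit p q x)"
    if "p \<noteq> q" for p q
    using that by (auto simp: elem_conj_def matrix_unit_def fun_eq_iff)
  have dd: "elem_conj p p 1 (-1/2) (matrix_unit d d) = (\<lambda>x. 1 * matrix_unit d d x)" for p d
    by (auto simp: elem_conj_def matrix_unit_def fun_eq_iff)
  have ab_ab: "\<beta> (matrix_unit p q) (matrix_unit p q) = 0" if "p \<noteq> q" for p q
    using that by (intro torus [OF ab2 ab2]) auto
  have ab_dd: "\<beta> (matrix_unit p q) (matrix_unit d d) = 0" if "p \<noteq> q" for p q d
    using that by (intro torus [OF ab2 dd]) auto
  have dd_ab: "\<beta> (matrix_unit d d) (matrix_unit p q) = 0" if "p \<noteq> q" for p q d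
    using that by (intro torus [OF dd ab2]) auto
  have aa: "elem_conj a b 1 (-1) (matrix_unit a a) =
      (\<lambda>x. matrix_unit a a x + (-1) * matrix_unit a b x)"
    using ab by (auto simp: elem_conj_def matrix_unit_def fun_eq_iff)
  have ba: "elem_conj a b 1 (-1) (matrix_unit b a) =
      (\<lambda>x. matrix_unit b a x + (matrix_unit a a x +
        ((-1) * matrix_unit b b x + (-1) * matrix_unit a b x)))"
    using ab by (auto simp: elem_conj_def matrix_unit_def fun_eq_iff)
  \<comment> \<open>Expanding the invariance of the pair (E_aa, E_ba) under 1 + E_ab, every mixed
    term vanishes and what remains is 0 = \<kappa> - \<beta>(E_ab, E_ba).\<close>
  show "\<beta> (matrix_unit a b) (matrix_unit b a) = \<kappa>"
    using inv [of 1 "-1" a b "matrix_unit a a" "matrix_unit b a"] ab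
    unfolding aa ba add_left add_right scale_left scale_right
    by (simp add: diag ab_ab ab_dd dd_ab)
  show "\<beta> (matrix_unit a b) (matrix_unit a b) = 0"
    "\<beta> (matrix_unit a b) (matrix_unit d d) = 0" "\<beta> (matrix_unit d d) (matrix_unit a b) = 0"
    using ab by (fact ab_ab ab_dd dd_ab)+
qed


section \<open>The component of a chain that is linear in degree 0 and in degree 1\<close>

definition linear_form :: "(complex \<Rightarrow> 'v::ab_group_add \<Rightarrow> 'v) \<Rightarrow> ('v \<Rightarrow> complex) \<Rightarrow> bool" where
  "linear_form smul \<alpha> \<longleftrightarrow>
     (\<forall>v w. \<alpha> (v + w) = \<alpha> v + \<alpha> w) \<and> (\<forall>c v. \<alpha> (smul c v) = c * \<alpha> v)"

definition wedge :: "('v \<Rightarrow> complex) \<Rightarrow> ('v \<Rightarrow> complex) \<Rightarrow> 'v \<Rightarrow> 'v \<Rightarrow> complex" where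
  "wedge \<alpha> \<beta> v w = \<alpha> v * \<beta> w - \<alpha> w * \<beta> v"

text \<open>These valuations evaluate the generators of degree 0 at \<open>\<alpha> \<otimes> m\<close> and those of degree 1 at
  \<open>\<omega> \<otimes> m\<close>.\<close>

definition linear_val :: "('v \<Rightarrow> complex) \<Rightarrow> ('x \<Rightarrow> complex) \<Rightarrow> 'x \<times> 'v list \<Rightarrow> complex" where
  "linear_val \<alpha> m = (\<lambda>(x, a). case a of [v] \<Rightarrow> \<alpha> v * m x | _ \<Rightarrow> 0)"

definition bilinear_val ::
  "('v \<Rightarrow> 'v \<Rightarrow> complex) \<Rightarrow> ('x \<Rightarrow> complex) \<Rightarrow> 'x \<times> 'v list \<Rightarrow> complex" where
  "bilinear_val \<omega> m = (\<lambda>(x, a). case a of [v, w] \<Rightarrow> \<omega> v w * m x | _ \<Rightarrow> 0)"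

text \<open>The bilinear form in two matrices obtained from the words of \<open>c\<close> with one
  letter in V and one in the second exterior power, after contracting these with \<alpha> and
  \<omega>.\<close>

definition form_on ::
  "('x \<times> 'v list) falg \<Rightarrow> ('v \<Rightarrow> complex) \<Rightarrow> ('v \<Rightarrow> 'v \<Rightarrow> complex) \<Rightarrow>
    ('x \<Rightarrow> complex) \<Rightarrow> ('x \<Rightarrow> complex) \<Rightarrow> complex" where
  "form_on c \<alpha> \<omega> m n = functional (pairing (linear_val \<alpha> m) (bilinear_val \<omega> n)) c"

lemma linear_val_eq_0: "length (snd s) \<noteq> 1 \<Longrightarrow> linear_val \<alpha> m s = 0"
  by (auto simp: linear_val_def split: prod.split list.split)

lemma linear_val_gen_deg: "linear_val \<alpha> m s \<noteq> 0 \<Longrightarrow> gen_deg s = 0"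
  using linear_val_eq_0 [of s \<alpha> m] by (cases "length (snd s) = 1") (auto simp: gen_deg_def)

lemma linear_val_singleton [simp]: "linear_val \<alpha> m (x, [v]) = \<alpha> v * m x"
  by (simp add: linear_val_def)

lemma linear_val_pair [simp]: "linear_val \<alpha> m (x, [v, w]) = 0"
  by (simp add: linear_val_def)

lemma bilinear_val_singleton [simp]: "bilinear_val \<omega> m (x, [v]) = 0"
  by (simp add: bilinear_val_def)

lemma bilinear_val_pair [simp]: "bilinear_val \<omega> m (x, [v, w]) = \<omega> v w * m x"
  by (simp add: bilinear_val_def)

lemma alt_multilinear_linear_val:
  assumes "linear_form smul \<alpha>"
  shows "alt_multilinear smul (linear_val \<alpha> m)"
proof -
  have "linear_val \<alpha> m (x, us @ v # vs) = (if us = [] \<and> vs = [] then \<alpha> v * m x else 0)"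
    for x us v vs
    by (cases us; cases vs) (auto simp: linear_val_def split: list.split)
  moreover have "linear_val \<alpha> m (x, vs) = 0" if "\<not> distinct vs" for x vs
    using that by (auto simp: linear_val_def split: list.split)
  ultimately show ?thesis
    using assms by (auto simp: alt_multilinear_def linear_form_def algebra_simps)
qed

lemma alt_multilinear_wedge:
  assumes "linear_form smul \<alpha>" "linear_form smul \<beta>"
  shows "alt_multilinear smul (bilinear_val (wedge \<alpha> \<beta>) m)"
proof -
  \<comment> \<open>With the other argument fixed, the wedge is a combination of \<alpha> and
    \<beta>, so additivity and homogeneity follow from theirs.\<close>
  have "\<exists>k l. \<forall>v. bilinear_val (wedge \<alpha> \<beta>) m (x, us @ v # vs) = \<alpha> v * k + \<beta> v * l"
    for x us vs
  proof -
    consider w where "us = []" "vs = [w]" | w where "us = [w]" "vs = []"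
      | "length us + length vs \<noteq> 1"
      by (cases us; cases vs) auto
    then show ?thesis
    proof cases
      case 1
      then show ?thesis
        by (intro exI [of _ "\<beta> w * m x"] exI [of _ "- \<alpha> w * m x"])
          (simp add: wedge_def algebra_simps)
    next
      case 2
      then show ?thesis
        by (intro exI [of _ "- \<beta> w * m x"] exI [of _ "\<alpha> w * m x"])
          (simp add: wedge_def algebra_simps)
    next
      case 3
      have "bilinear_val \<omega> m (x, a) = 0" if "length a \<noteq> 2" for a and \<omega> :: "'a \<Rightarrow> 'a \<Rightarrow> complex"
        using that by (auto simp: bilinear_val_def split: list.split)
      with 3 show ?thesis
        by (intro exI [of _ 0]) simp
    qed
  qed
  then obtain k l where
    kl: "bilinear_val (wedge \<alpha> \<beta>) m (x, us @ v # vs) = \<alpha> v * k x us vs + \<beta> v * l x us vs"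
    for x us v vs
    by metis
  have "bilinear_val (wedge \<alpha> \<beta>) m (x, vs) = 0" if "\<not> distinct vs" for x vs
    using that by (auto simp: bilinear_val_def wedge_def split: list.split)
  with assms show ?thesis
    by (auto simp: alt_multilinear_def linear_form_def kl algebra_simps)
qed

lemma alt_multilinear_add:
  assumes "alt_multilinear smul P" "alt_multilinear smul Q"
  shows "alt_multilinear smul (\<lambda>s. P s + Q s)"
  using assms by (simp add: alt_multilinear_def algebra_simps)

section \<open>Bilinearity in the two matrices\<close>

lemma functional_fun_add: "functional (\<lambda>w. F w + G w) x = functional F x + functional G x"
  by (simp add: functional_def algebra_simps sum.distrib)

lemma functional_fun_scale: "functional (\<lambda>w. k * F w) x = k * functional F x"
  by (simp add: functional_def sum_distrib_left mult_ac)

lemma pairing_add_left: "pairing (\<lambda>s. P s + P' s) Q = (\<lambda>w. pairing P Q w + pairing P' Q w)"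
  by (auto simp: pairing_def fun_eq_iff algebra_simps split: list.split)

lemma pairing_add_right: "pairing P (\<lambda>s. Q s + Q' s) = (\<lambda>w. pairing P Q w + pairing P Q' w)"
  by (auto simp: pairing_def fun_eq_iff algebra_simps split: list.split)

lemma pairing_scale_left: "pairing (\<lambda>s. k * P s) Q = (\<lambda>w. k * pairing P Q w)"
  by (auto simp: pairing_def fun_eq_iff algebra_simps split: list.split)

lemma pairing_scale_right: "pairing P (\<lambda>s. k * Q s) = (\<lambda>w. k * pairing P Q w)"
  by (auto simp: pairing_def fun_eq_iff algebra_simps split: list.split)

lemmas functional_pairing_bilinear =
  pairing_add_left pairing_add_right pairing_scale_left pairing_scale_right
  functional_fun_add functional_fun_scale

lemma linear_val_add: "linear_val \<alpha> (\<lambda>x. m x + m' x) = (\<lambda>s. linear_val \<alpha> m s + linear_val \<alpha> m' s)"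
  by (auto simp: linear_val_def fun_eq_iff algebra_simps split: list.split)

lemma linear_val_scale: "linear_val \<alpha> (\<lambda>x. k * m x) = (\<lambda>s. k * linear_val \<alpha> m s)"
  by (auto simp: linear_val_def fun_eq_iff split: list.split)

lemma bilinear_val_add:
  "bilinear_val \<omega> (\<lambda>x. m x + m' x) = (\<lambda>s. bilinear_val \<omega> m s + bilinear_val \<omega> m' s)"
  by (auto simp: bilinear_val_def fun_eq_iff algebra_simps split: list.split)

lemma bilinear_val_scale: "bilinear_val \<omega> (\<lambda>x. k * m x) = (\<lambda>s. k * bilinear_val \<omega> m s)"
  by (auto simp: bilinear_val_def fun_eq_iff split: list.split)

section \<open>Elementary matrices and invariance under conjugation\<close>

definition elem_matrix :: "'n::finite \<Rightarrow> 'n \<Rightarrow> complex \<Rightarrow> complex^'n^'n" where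
  "elem_matrix a b t = (\<chi> i j. of_bool (i = j) + of_bool (i = a \<and> j = b) * t)"

lemma sum_elem_matrix_left:
  "(\<Sum>k\<in>UNIV. elem_matrix a b s $ i $ k * f k) = f i + of_bool (i = a) * s * f b"
  by (simp add: elem_matrix_def distrib_right sum.distrib of_bool_def if_distrib [of "\<lambda>x. x * _"]
    cong: if_cong)

lemma sum_elem_matrix_right:
  "(\<Sum>k\<in>UNIV. elem_matrix a b t $ k $ j * f k) = f j + of_bool (j = b) * t * f a"
  by (simp add: elem_matrix_def distrib_right sum.distrib of_bool_def if_distrib [of "\<lambda>x. x * _"]
    cong: if_cong)

text \<open>The product is 1 + (s + t) E_ab + s t E_ab^2, and E_ab^2 is E_ab if \<open>a = b\<close>
  and zero otherwise. One condition thus covers unipotent and diagonal matrices.\<close>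

lemma elem_matrix_mult:
  assumes "s + t + of_bool (a = b) * s * t = 0"
  shows "elem_matrix a b s ** elem_matrix a b t = mat 1"
proof -
  have "elem_matrix a b t $ i $ j + of_bool (i = a) * s * elem_matrix a b t $ b $ j =
      of_bool (i = j)" for i j
  proof (cases "a = b")
    case True
    with assms have "t + s * (1 + t) = 0"
      by (simp add: algebra_simps)
    with True show ?thesis
      by (auto simp: elem_matrix_def add.assoc)
  next
    case False
    with assms show ?thesis
      by (auto simp: elem_matrix_def add_eq_0_iff2)
  qed
  then show ?thesis
    by (auto simp: vec_eq_iff matrix_matrix_mult_def sum_elem_matrix_left mat_def)
qed

lemma matrix_inv_elem_matrix:
  assumes "s + t + of_bool (a = b) * s * t = 0"
  shows "invertible (elem_matrix a b t)" "matrix_inv (elem_matrix a b t) = elem_matrix a b s"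
proof -
  have l: "elem_matrix a b s ** elem_matrix a b t = mat 1"
    using assms by (rule elem_matrix_mult)
  have r: "elem_matrix a b t ** elem_matrix a b s = mat 1"
    using assms by (intro elem_matrix_mult) (simp add: algebra_simps)
  show "invertible (elem_matrix a b t)"
    using l r by (auto simp: invertible_def)
  \<comment> \<open>\<open>matrix_inv\<close> is a choice of inverse, so it is computed by showing
    that the inverse is unique.\<close>
  have unique: "A = elem_matrix a b s" if "A ** elem_matrix a b t = mat 1" for A
    using arg_cong [OF that, of "\<lambda>B. B ** elem_matrix a b s"] r by (simp flip: matrix_mul_assoc)
  show "matrix_inv (elem_matrix a b t) = elem_matrix a b s"
    unfolding matrix_inv_def by (rule some_equality) (use l r unique in \<open>blast+\<close>)
qed

lemma elem_conj_eq_sum: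
  "(\<Sum>k\<in>UNIV. \<Sum>l\<in>UNIV. elem_matrix a b s $ i $ k * elem_matrix a b t $ l $ j * m (k, l)) =
    elem_conj a b s t m (i, j)"
  by (simp add: mult.assoc sum_elem_matrix_left sum_elem_matrix_right elem_conj_def
    flip: sum_distrib_left) (simp add: algebra_simps of_bool_conj)

text \<open>The action substitutes linearly in the generators, so pulling the pairing back along it
  conjugates both matrices. The pairing vanishes on the ideal and hence does not distinguish
  \<open>GL_act g c\<close> from \<open>c\<close>.\<close>

lemma form_on_elem_conj:
  fixes c :: "(('n::finite \<times> 'n) \<times> 'v::ab_group_add list) falg"
  assumes inv: "\<And>g::complex^'n^'n. invertible g \<Longrightarrow> GL_act g c - c \<in> sym_ideal smul r"
    and lin: "linear_form smul \<alpha>" "linear_form smul \<beta>" "linear_form smul \<gamma>"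
    and st: "s + t + of_bool (a = b) * s * t = 0"
  shows "form_on c \<alpha> (wedge \<beta> \<gamma>) (elem_conj a b s t m) (elem_conj a b s t n) =
    form_on c \<alpha> (wedge \<beta> \<gamma>) m n"
proof -
  let ?g = "elem_matrix a b t"
  define \<phi> :: "('n \<times> 'n) \<times> 'v list \<Rightarrow> (('n \<times> 'n) \<times> 'v list) falg" where
    "\<phi> = (\<lambda>((i, j), v). \<Sum>k\<in>UNIV. \<Sum>l\<in>UNIV.
      scalar (elem_matrix a b s $ i $ k * ?g $ l $ j) * gen ((k, l), v))"
  have GL: "GL_act ?g = alg_hom \<phi>"
    by (simp add: GL_act_def \<phi>_def matrix_inv_elem_matrix [OF st])
  have \<phi>: "len_hom 1 (\<phi> s)" for s
    by (auto simp: \<phi>_def intro!: len_hom_sum len_hom_scalar_mult len_hom_gen [simplified]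
      split: prod.split)
  have P: "(\<lambda>s. functional (letter (linear_val \<alpha> m)) (\<phi> s)) = linear_val \<alpha> (elem_conj a b s t m)"
    by (auto simp: fun_eq_iff \<phi>_def linear_val_def sum_distrib_left mult_ac
      simp flip: elem_conj_eq_sum split: list.split)
  have Q: "(\<lambda>s. functional (letter (bilinear_val \<omega> n)) (\<phi> s)) =
      bilinear_val \<omega> (elem_conj a b s t n)" for \<omega>
    by (auto simp: fun_eq_iff \<phi>_def bilinear_val_def sum_distrib_left mult_ac
      simp flip: elem_conj_eq_sum split: list.split)
  have "functional (pairing (linear_val \<alpha> m) (bilinear_val (wedge \<beta> \<gamma>) n)) (GL_act ?g c - c) = 0"
    using inv [OF matrix_inv_elem_matrix(1) [OF st]] lin
    by (intro functional_pairing_sym_ideal alt_multilinear_linear_val alt_multilinear_wedge)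
      (auto dest: linear_val_gen_deg)
  then show ?thesis
    by (simp add: GL functional_pairing_alg_hom [OF \<phi>] P Q form_on_def)
qed

section \<open>The cyclic class and its contradiction with the cycle condition\<close>

definition cyclic_class :: "'v \<Rightarrow> 'v \<Rightarrow> 'v \<Rightarrow> ('n::finite \<times> 'v list) falg" where
  "cyclic_class x y z = (\<Sum>i\<in>UNIV. gen (i, [x]) * gen (i, [y, z]) +
     gen (i, [y]) * gen (i, [z, x]) + gen (i, [z]) * gen (i, [x, y]))"

lemma form_on_diagonal:
  fixes c :: "(('n::finite \<times> 'n) \<times> 'v::ab_group_add list) falg"
  assumes hc: "harish_chandra c - cyclic_class x y z \<in> sym_ideal smul r"
    and lin: "linear_form smul \<alpha>" "linear_form smul \<beta>" "linear_form smul \<gamma>"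
  shows "form_on c \<alpha> (wedge \<beta> \<gamma>) (matrix_unit a a) (matrix_unit b b) = of_bool (a = b) *
    (\<alpha> x * wedge \<beta> \<gamma> y z + \<alpha> y * wedge \<beta> \<gamma> z x + \<alpha> z * wedge \<beta> \<gamma> x y)"
proof -
  define \<phi> :: "('n \<times> 'n) \<times> 'v list \<Rightarrow> ('n \<times> 'v list) falg" where
    "\<phi> = (\<lambda>((i, j), v). if i = j then gen (i, v) else 0)"
  have \<phi>: "len_hom 1 (\<phi> s)" for s
    using len_hom_gen by (auto simp: \<phi>_def split: prod.split)
  \<comment> \<open>Under the restriction to diagonal matrices, the indicator of the coordinate
    \<open>a\<close> pulls back to the matrix unit E_aa.\<close>
  have P: "(\<lambda>s. functional (letter (linear_val \<alpha> (\<lambda>i. of_bool (i = a)))) (\<phi> s)) =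
      linear_val \<alpha> (matrix_unit a a)"
    by (auto simp: fun_eq_iff \<phi>_def linear_val_def matrix_unit_def split: list.split)
  have Q: "(\<lambda>s. functional (letter (bilinear_val \<omega> (\<lambda>i. of_bool (i = b)))) (\<phi> s)) =
      bilinear_val \<omega> (matrix_unit b b)" for \<omega>
    by (auto simp: fun_eq_iff \<phi>_def bilinear_val_def matrix_unit_def split: list.split)
  let ?F = "functional (pairing (linear_val \<alpha> (\<lambda>i. of_bool (i = a)))
    (bilinear_val (wedge \<beta> \<gamma>) (\<lambda>i. of_bool (i = b))))"
  have "?F (harish_chandra c - cyclic_class x y z) = 0"
    using hc lin
    by (intro functional_pairing_sym_ideal alt_multilinear_linear_val alt_multilinear_wedge)
      (auto dest: linear_val_gen_deg)
  then have "form_on c \<alpha> (wedge \<beta> \<gamma>) (matrix_unit a a) (matrix_unit b b) = ?F (cyclic_class x y z)"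
    by (simp add: harish_chandra_def \<phi>_def [symmetric] functional_pairing_alg_hom [OF \<phi>] P Q
      form_on_def)
  also have "\<dots> = (\<Sum>i\<in>UNIV. if i = a then of_bool (a = b) *
    (\<alpha> x * wedge \<beta> \<gamma> y z + \<alpha> y * wedge \<beta> \<gamma> z x + \<alpha> z * wedge \<beta> \<gamma> x y) else 0)"
    unfolding cyclic_class_def functional_sum
    by (intro sum.cong refl) (auto simp: gen_mult_gen)
  finally show ?thesis
    by simp
qed

text \<open>Expand the commutator bilinearly: [E_aa, E_ab] = E_ab, [E_ab, E_ba] = E_aa - E_bb and
  [E_ba, E_aa] = E_ba, each weighted by the wedge of the two forms involved.\<close>

lemma commutator_val_matrix_units:
  fixes a b :: "'n::finite"
  assumes "a \<noteq> b"
  shows "commutator_val (\<lambda>s. linear_val \<xi> (matrix_unit a a) s + linear_val \<eta> (matrix_unit a b) s +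
      linear_val \<zeta> (matrix_unit b a) s) =
    (\<lambda>s. bilinear_val (wedge \<xi> \<eta>) (matrix_unit a b) s +
      bilinear_val (wedge \<eta> \<zeta>) (matrix_unit a a) s +
      - 1 * bilinear_val (wedge \<eta> \<zeta>) (matrix_unit b b) s +
      bilinear_val (wedge \<zeta> \<xi>) (matrix_unit b a) s)"
    (is "commutator_val ?P = ?Q")
proof
  fix s :: "('n \<times> 'n) \<times> 'a list"
  obtain i j u where s: "s = ((i, j), u)" by (metis surj_pair)
  show "commutator_val ?P s = ?Q s"
  proof (cases "length u = 2")
    case False
    then show ?thesis
      by (auto simp: s commutator_val_def bilinear_val_def split: list.split)
  next
    case True
    then obtain v w where u: "u = [v, w]"
      by (auto simp: length_Suc_conv numeral_2_eq_2)
    \<comment> \<open>The three matrix units live on the indices \<open>a\<close> and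
      \<open>b\<close>, so no other middle index contributes.\<close>
    have "commutator_val ?P s = (\<Sum>l\<in>{a, b}. ?P ((i, l), [v]) * ?P ((l, j), [w]) -
        ?P ((i, l), [w]) * ?P ((l, j), [v]))"
      unfolding s u commutator_val_def
      by (simp, intro sum.mono_neutral_right) (auto simp: matrix_unit_def)
    also have "\<dots> = ?Q s"
      using assms unfolding s u
      by (cases "i = a"; cases "i = b"; cases "j = a"; cases "j = b")
        (simp_all add: matrix_unit_def wedge_def algebra_simps)
    finally show ?thesis .
  qed
qed

text \<open>The differential of \<open>c\<close> is evaluated at the point \<xi> E_aa + \<eta> E_ab
  + \<zeta> E_ba. The cycle condition gives 0, whereas the values forced by invariance and by the
  restriction to diagonal matrices give -3.\<close>

lemma cyclic_class_not_hit:
  fixes c :: "(('n::finite \<times> 'n) \<times> 'v::ab_group_add list) falg" and a b :: 'n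
  assumes c: "c \<in> homogeneous r 1"
    and inv: "\<And>g::complex^'n^'n. invertible g \<Longrightarrow> GL_act g c - c \<in> sym_ideal smul r"
    and cycle: "drep_d c \<in> sym_ideal smul r"
    and lin: "linear_form smul \<xi>" "linear_form smul \<eta>" "linear_form smul \<zeta>"
    and dual: "\<xi> x = 1" "\<xi> y = 0" "\<xi> z = 0" "\<eta> x = 0" "\<eta> y = 1" "\<eta> z = 0"
      "\<zeta> x = 0" "\<zeta> y = 0" "\<zeta> z = 1"
    and ab: "a \<noteq> b"
  shows "harish_chandra c - cyclic_class x y z \<notin> sym_ideal smul r"
proof
  assume hc: "harish_chandra c - cyclic_class x y z \<in> sym_ideal smul r"
  have vals: "form_on c \<alpha> (wedge \<beta> \<gamma>) (matrix_unit p q) (matrix_unit q p) =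
      \<alpha> x * wedge \<beta> \<gamma> y z + \<alpha> y * wedge \<beta> \<gamma> z x + \<alpha> z * wedge \<beta> \<gamma> x y"
    "form_on c \<alpha> (wedge \<beta> \<gamma>) (matrix_unit p q) (matrix_unit p q) = 0"
    "form_on c \<alpha> (wedge \<beta> \<gamma>) (matrix_unit p q) (matrix_unit d d) = 0"
    "form_on c \<alpha> (wedge \<beta> \<gamma>) (matrix_unit d d) (matrix_unit p q) = 0"
    if "linear_form smul \<alpha>" "linear_form smul \<beta>" "linear_form smul \<gamma>" "p \<noteq> q"
    for \<alpha> \<beta> \<gamma> p q d
  proof -
    let ?\<beta> = "form_on c \<alpha> (wedge \<beta> \<gamma>)"
    have bilinear: "?\<beta> (\<lambda>x. m x + m' x) n = ?\<beta> m n + ?\<beta> m' n"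
      "?\<beta> m (\<lambda>x. n x + n' x) = ?\<beta> m n + ?\<beta> m n'"
      "?\<beta> (\<lambda>x. u * m x) n = u * ?\<beta> m n" "?\<beta> m (\<lambda>x. u * n x) = u * ?\<beta> m n"
      for m m' n n' u
      by (simp_all add: form_on_def linear_val_add linear_val_scale bilinear_val_add
          bilinear_val_scale functional_pairing_bilinear)
    note facts = invariant_form_values [OF bilinear form_on_elem_conj [OF inv that(1-3)]
        form_on_diagonal [OF hc that(1-3)] that(4)]
    show "?\<beta> (matrix_unit p q) (matrix_unit q p) =
        \<alpha> x * wedge \<beta> \<gamma> y z + \<alpha> y * wedge \<beta> \<gamma> z x + \<alpha> z * wedge \<beta> \<gamma> x y"
      "?\<beta> (matrix_unit p q) (matrix_unit p q) = 0"
      "?\<beta> (matrix_unit p q) (matrix_unit d d) = 0"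
      "?\<beta> (matrix_unit d d) (matrix_unit p q) = 0"
      by (rule facts; assumption)+
  qed
  let ?P = "\<lambda>s. linear_val \<xi> (matrix_unit a a) s + linear_val \<eta> (matrix_unit a b) s +
    linear_val \<zeta> (matrix_unit b a) s"
  have "alt_multilinear smul ?P"
    by (intro alt_multilinear_add alt_multilinear_linear_val lin)
  moreover have "gen_deg s = 0" if "?P s \<noteq> 0" for s
    using that by (cases "length (snd s) = 1") (simp_all add: gen_deg_def linear_val_eq_0)
  ultimately have "functional (cubic ?P) (drep_d c) = 0"
    by (intro functional_cubic_sym_ideal [OF cycle])
  moreover have "functional (cubic ?P) (drep_d c) =
      - functional (pairing ?P (commutator_val ?P)) c"
    by (rule functional_cubic_drep_d [OF c]) (simp add: linear_val_eq_0)
  ultimately have "functional (pairing ?P (commutator_val ?P)) c = 0"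
    by simp
  moreover have "functional (pairing ?P (commutator_val ?P)) c =
    (let f = (\<lambda>\<alpha> m. form_on c \<alpha> (wedge \<xi> \<eta>) m (matrix_unit a b) +
       form_on c \<alpha> (wedge \<eta> \<zeta>) m (matrix_unit a a) +
       - 1 * form_on c \<alpha> (wedge \<eta> \<zeta>) m (matrix_unit b b) +
       form_on c \<alpha> (wedge \<zeta> \<xi>) m (matrix_unit b a))
     in f \<xi> (matrix_unit a a) + f \<eta> (matrix_unit a b) + f \<zeta> (matrix_unit b a))"
    unfolding commutator_val_matrix_units [OF ab] functional_pairing_bilinear form_on_def Let_def
    by (simp only: add_ac)
  \<comment> \<open>Of the twelve terms, those pairing a diagonal with an off-diagonal unit, or an
    off-diagonal unit with itself, vanish. Four are left.\<close>
  ultimately have "form_on c \<xi> (wedge \<eta> \<zeta>) (matrix_unit a a) (matrix_unit a a) -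
      form_on c \<xi> (wedge \<eta> \<zeta>) (matrix_unit a a) (matrix_unit b b) +
      form_on c \<eta> (wedge \<zeta> \<xi>) (matrix_unit a b) (matrix_unit b a) +
      form_on c \<zeta> (wedge \<xi> \<eta>) (matrix_unit b a) (matrix_unit a b) = 0"
    using ab ab [symmetric] by (simp add: Let_def vals lin)
  \<comment> \<open>By duality the first, third and fourth terms are 1, and the second is 0 because
    it pairs distinct diagonal units; the equation reads 3 = 0.\<close>
  then show False
    using lin ab dual by (simp add: vals form_on_diagonal [OF hc] wedge_def)
qed


section \<open>The derived Harish-Chandra homomorphism in degree 1\<close>

lemma exists_dual_triple:
  assumes "finite_dimensional_vector_space smul B"
    and "vector_space.dim smul (UNIV :: 'v::ab_group_add set) = r" and "r \<ge> 3"
  obtains x y z :: "'v::ab_group_add" and \<xi> \<eta> \<zeta> where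
    "linear_form smul \<xi>" "linear_form smul \<eta>" "linear_form smul \<zeta>"
    "\<xi> x = 1" "\<xi> y = 0" "\<xi> z = 0" "\<eta> x = 0" "\<eta> y = 1" "\<eta> z = 0"
    "\<zeta> x = 0" "\<zeta> y = 0" "\<zeta> z = 1"
proof -
  interpret finite_dimensional_vector_space smul B by fact
  obtain T where "T \<subseteq> B" "card T = 3"
    using assms dim_UNIV by (metis obtain_subset_with_card_n)
  then obtain x y z where T: "x \<in> B" "y \<in> B" "z \<in> B" "x \<noteq> y" "x \<noteq> z" "y \<noteq> z"
    by (auto simp: card_3_iff)
  \<comment> \<open>Coordinate functions of the basis \<open>B\<close>, which are dual to the three
    chosen basis vectors.\<close>
  define \<rho> where "\<rho> b v = representation B v b" for b v
  have lin: "linear_form smul (\<rho> b)" for b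
    by (simp add: linear_form_def \<rho>_def representation_add representation_scale
        independent_Basis span_Basis)
  have "\<rho> b b' = of_bool (b = b')" if "b' \<in> B" for b b'
    using that by (auto simp: \<rho>_def representation_basis independent_Basis)
  with that [of "\<rho> x" "\<rho> y" "\<rho> z" x y z] lin T show ?thesis
    by auto
qed

section \<open>The cyclic class as a chain of the target complex\<close>

lemma word_in_homogeneous:
  assumes "set w \<subseteq> gens r" "sum_list (map gen_deg w) = k"
  shows "word w \<in> homogeneous r k"
  using assms by (simp add: homogeneous_def free_on_gens_def word_def)

lemma zero_in_homogeneous: "0 \<in> homogeneous r k"
  by (simp add: homogeneous_def free_on_gens_def)

lemma add_in_homogeneous:
  "x \<in> homogeneous r k \<Longrightarrow> y \<in> homogeneous r k \<Longrightarrow> x + y \<in> homogeneous r k"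
  using Poly_Mapping.keys_add [of x y] by (fastforce simp: homogeneous_def free_on_gens_def)

lemma sum_in_homogeneous:
  "(\<And>a. a \<in> A \<Longrightarrow> f a \<in> homogeneous r k) \<Longrightarrow> sum f A \<in> homogeneous r k"
  by (induction A rule: infinite_finite_induct)
    (auto intro: zero_in_homogeneous add_in_homogeneous)

lemma zero_in_sym_ideal: "0 \<in> sym_ideal smul r"
  by (simp add: sym_ideal_def ideal_gen.zero)

lemma cyclic_class_in_homogeneous: "3 \<le> r \<Longrightarrow> cyclic_class x y z \<in> homogeneous r 1"
  unfolding cyclic_class_def gen_mult_gen
  by (intro sum_in_homogeneous add_in_homogeneous word_in_homogeneous)
    (auto simp: gens_def gen_deg_def)

text \<open>A permutation only reindexes the sum over \<open>i\<close>, so invariance holds already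
  in the free algebra, before passing to the quotient.\<close>

lemma Sn_act_cyclic_class:
  fixes \<pi> :: "'n::finite \<Rightarrow> 'n"
  assumes "\<pi> permutes UNIV"
  shows "Sn_act \<pi> (cyclic_class x y z) = cyclic_class x y z"
proof -
  have "Sn_act \<pi> (cyclic_class x y z) = (\<Sum>i\<in>UNIV. gen (\<pi> i, [x]) * gen (\<pi> i, [y, z]) +
      gen (\<pi> i, [y]) * gen (\<pi> i, [z, x]) + gen (\<pi> i, [z]) * gen (\<pi> i, [x, y]))"
    by (simp add: Sn_act_def alg_hom_def cyclic_class_def gen_mult_gen lin_ext_sum lin_ext_add
        lin_ext_word)
  also have "\<dots> = cyclic_class x y z"
    unfolding cyclic_class_def by (rule sum.permute [OF assms, unfolded o_def, symmetric])
  finally show ?thesis .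
qed

theorem proposition5p1:
  fixes smul :: "complex \<Rightarrow> 'v::ab_group_add \<Rightarrow> 'v" and B :: "'v set" and r :: nat
  assumes "finite_dimensional_vector_space smul B"
    and "vector_space.dim smul (UNIV :: 'v set) = r"
    and "r \<ge> 3"
    and "CARD('n::finite) \<ge> 2"
  shows "\<not> quasi_iso
      (DRep_Sym_GL smul r :: (('n \<times> 'n) \<times> 'v list) falg complex_rep)
      (Sym_cartan_Sn smul r :: ('n \<times> 'v list) falg complex_rep)
      harish_chandra"
proof
  let ?C = "DRep_Sym_GL smul r :: (('n \<times> 'n) \<times> 'v list) falg complex_rep"
  let ?D = "Sym_cartan_Sn smul r :: ('n \<times> 'v list) falg complex_rep"
  assume "quasi_iso ?C ?D harish_chandra"
  then have surj: "homology_map ?D harish_chandra 1 ` homology ?C 1 = homology ?D 1"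
    unfolding quasi_iso_def bij_betw_def by blast
  obtain x y z \<xi> \<eta> \<zeta> where lin: "linear_form smul \<xi>" "linear_form smul \<eta>" "linear_form smul \<zeta>"
    and dual: "\<xi> x = 1" "\<xi> y = 0" "\<xi> z = 0" "\<eta> x = 0" "\<eta> y = 1" "\<eta> z = 0"
      "\<zeta> x = 0" "\<zeta> y = 0" "\<zeta> z = 1"
    using exists_dual_triple [OF assms(1-3)] by metis
  have "\<exists>a b :: 'n. a \<noteq> b"
    using assms(4) card_le_Suc0_iff_eq [of "UNIV :: 'n set"] by force
  then obtain a b :: 'n where "a \<noteq> b"
    by blast
  let ?t = "cyclic_class x y z :: ('n \<times> 'v list) falg"
  have t: "?t \<in> cycles ?D 1"
    using assms(3)
    by (simp add: cycles_def Sym_cartan_Sn_def zero_in_sym_ideal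
        cyclic_class_in_homogeneous [unfolded One_nat_def]
        Sn_act_cyclic_class)
  \<comment> \<open>Reflexivity, with 0 as the bounding chain: it places \<open>?t\<close> inside
    its own homology class, so that surjectivity can be applied to that element.\<close>
  then have "(?t, ?t) \<in> homologous ?D 1"
    by (auto simp: homologous_def boundaries_def Sym_cartan_Sn_def zero_in_sym_ideal Sn_act_def
        alg_hom_def lin_ext_def zero_in_homogeneous intro: exI [of _ 0])
  moreover have "homologous ?D 1 `` {?t} \<in> homology ?D 1"
    unfolding homology_def using t by (rule quotientI)
  ultimately obtain X where X: "X \<in> homology ?C 1"
    and "?t \<in> homology_map ?D harish_chandra 1 X"
    unfolding surj [symmetric] by blast
  then obtain c where "c \<in> X" and ct: "(harish_chandra c, ?t) \<in> homologous ?D 1"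
    by (auto simp: homology_map_def)
  from \<open>c \<in> X\<close> X have "c \<in> cycles ?C 1"
    by (auto simp: homology_def quotient_def homologous_def)
  then have c: "c \<in> homogeneous r 1" "drep_d c \<in> sym_ideal smul r"
    "\<And>g::complex^'n^'n. invertible g \<Longrightarrow> GL_act g c - c \<in> sym_ideal smul r"
    by (auto simp: cycles_def DRep_Sym_GL_def DRep_Sym_def)
  \<comment> \<open>The target differential is zero, so homologous representatives differ by an
    element of the ideal alone.\<close>
  from ct have "harish_chandra c - ?t \<in> sym_ideal smul r"
    by (auto simp: homologous_def boundaries_def Sym_cartan_Sn_def)
  with cyclic_class_not_hit [OF c(1) c(3) c(2) lin dual \<open>a \<noteq> b\<close>] show False
    by blast
qed

end
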